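(* Let $I\in\mathbb V$ be an infinite set, let $\alpha,\beta\in{}^*I\setminus\{{}^*i\mid i\in I\}$ and let $X\subseteq I\times I$. (1) If $({}^\circledast\alpha,{}^*\beta)\in{}^{**}X$ then there exist one-to-one sequences $(a_n)_{n\in\mathbb N}$ and $(b_m)_{m\in\mathbb N}$ of elements of $I$ such that $(a_n,b_m)\in X$ for all $n\le m$. (2) If $({}^\circledast\alpha,{}^*\alpha)\in{}^{**}X$ then there exists a one-to-one sequence $(h_n)_{n\in\mathbb N}$ of elements of $I$ such that $(h_n,h_m)\in X$ for all $n<m$.
   Context: Let $\mathbf X$ be a set of atoms with $\mathbb R\subseteq\mathbf X$, and $\mathbb V=\bigcup_{k\ge0}V_k(\mathbf X)$ the superstructure over $\mathbf X$. Fix a star map $*:\mathbb V\to\mathbb V$, also written $\mathfrak s$, such that ${}^*\mathbf X=\mathbf X$, ${}^*r=r$ for $r\in\mathbb R$, ${}^*\mathbb N\neq\mathbb N$, and transfer holds for bounded-quantifier formulas ($\varphi(A_1,\dots,A_k)\iff\varphi({}^*A_1,\dots,{}^*A_k)$ for $A_i\in\mathbb V$). ${}^{**}X={}^*({}^*X)$. The internal universe is $\mathbb V_1=\bigcup_{Y\in\mathbb V}{}^*Y$. For $Y\in\mathbb V$, $\mathfrak s\upharpoonright Y\in\mathbb V$; the internal star map $\circledast:\mathbb V_1\to\mathbb V$ is $\bigcup_{Y\in\mathbb V}{}^*(\mathfrak s\upharpoonright Y)$, written ${}^\circledast\xi$. *)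

theory Defs
  imports Complex_Main
begin

text \<open>
  The superstructure over an infinite set of atoms is larger than every type that can be built in
  HOL, so it is not constructed: a type \<open>'u\<close>, with \<open>elts x\<close> the set of members of \<open>x\<close> and
  a set of urelements \<open>atoms\<close>, is required to be one (locale \<open>superstructure\<close> below).
  Objects outside \<open>atoms\<close> are the sets of the superstructure.
\<close>

primrec stage :: "('u \<Rightarrow> 'u set) \<Rightarrow> 'u set \<Rightarrow> nat \<Rightarrow> 'u set" where
  "stage elts atoms 0 = atoms"
| "stage elts atoms (Suc k) =
     stage elts atoms k \<union> {y. y \<notin> atoms \<and> elts y \<subseteq> stage elts atoms k}"

text \<open>
  \<open>full\<close> makes each stage contain the whole power set of the previous one;
  \<open>exhaust\<close> makes \<open>'u\<close> the union of the finite stages and nothing more.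
\<close>

locale superstructure =
  fixes elts :: "'u \<Rightarrow> 'u set" and atoms :: "'u set"
  assumes atom_empty: "\<And>a. a \<in> atoms \<Longrightarrow> elts a = {}"
    and ext: "\<And>x y. x \<notin> atoms \<Longrightarrow> y \<notin> atoms \<Longrightarrow> elts x = elts y \<Longrightarrow> x = y"
    and full: "\<And>S k. S \<subseteq> stage elts atoms k \<Longrightarrow> \<exists>y. y \<notin> atoms \<and> elts y = S"
    and exhaust: "(\<Union>k. stage elts atoms k) = UNIV"

text \<open>
  The element of the superstructure with member set \<open>S\<close>; meaningful only for \<open>S\<close> contained
  in some stage.
\<close>

definition mkset :: "('u \<Rightarrow> 'u set) \<Rightarrow> 'u set \<Rightarrow> 'u set \<Rightarrow> 'u" where
  "mkset elts atoms S = (THE y. y \<notin> atoms \<and> elts y = S)"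

definition opair :: "('u \<Rightarrow> 'u set) \<Rightarrow> 'u set \<Rightarrow> 'u \<Rightarrow> 'u \<Rightarrow> 'u" where
  "opair elts atoms a b =
     mkset elts atoms {mkset elts atoms {a}, mkset elts atoms {a, b}}"

text \<open>
  Bounded-quantifier formulas of the language of set theory, with variables named by numbers.
  The parameters of a formula are the values of its free variables. In \<open>BAll i j p\<close>, read
  ``for all \<open>v\<^sub>i\<close> in \<open>v\<^sub>j\<close>, \<open>p\<close>'', the bound \<open>v\<^sub>j\<close> lies outside the scope of the
  quantifier, also when \<open>i = j\<close>.
\<close>

datatype bformula =
    Mem nat nat
  | Eq nat nat
  | Neg bformula
  | Conj bformula bformula
  | Disj bformula bformula
  | Imp bformula bformula
  | BAll nat nat bformula
  | BEx nat nat bformula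

primrec sat :: "('u \<Rightarrow> 'u set) \<Rightarrow> (nat \<Rightarrow> 'u) \<Rightarrow> bformula \<Rightarrow> bool" where
  "sat elts v (Mem i j) \<longleftrightarrow> v i \<in> elts (v j)"
| "sat elts v (Eq i j) \<longleftrightarrow> v i = v j"
| "sat elts v (Neg p) \<longleftrightarrow> \<not> sat elts v p"
| "sat elts v (Conj p q) \<longleftrightarrow> sat elts v p \<and> sat elts v q"
| "sat elts v (Disj p q) \<longleftrightarrow> sat elts v p \<or> sat elts v q"
| "sat elts v (Imp p q) \<longleftrightarrow> (sat elts v p \<longrightarrow> sat elts v q)"
| "sat elts v (BAll i j p) \<longleftrightarrow> (\<forall>x \<in> elts (v j). sat elts (v(i := x)) p)"
| "sat elts v (BEx i j p) \<longleftrightarrow> (\<exists>x \<in> elts (v j). sat elts (v(i := x)) p)"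

text \<open>The injection \<open>real_atom\<close> expresses that the reals are among the atoms.\<close>

locale star_map = superstructure elts atoms
  for elts :: "'u \<Rightarrow> 'u set" and atoms :: "'u set" +
  fixes real_atom :: "real \<Rightarrow> 'u" and star :: "'u \<Rightarrow> 'u"
  assumes inj_real_atom: "inj real_atom"
    and real_atom_in: "range real_atom \<subseteq> atoms"
    and star_atoms: "star (mkset elts atoms atoms) = mkset elts atoms atoms"
    and star_real: "\<And>r. star (real_atom r) = real_atom r"
    and star_Nats: "star (mkset elts atoms (real_atom ` \<nat>)) \<noteq> mkset elts atoms (real_atom ` \<nat>)"
    and transfer: "\<And>p v. sat elts v p \<longleftrightarrow> sat elts (star \<circ> v) p"

definition star_restrict :: "('u \<Rightarrow> 'u set) \<Rightarrow> 'u set \<Rightarrow> ('u \<Rightarrow> 'u) \<Rightarrow> 'u \<Rightarrow> 'u" where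
  "star_restrict elts atoms star Y = mkset elts atoms ((\<lambda>y. opair elts atoms y (star y)) ` elts Y)"

text \<open>
  The union of the graphs \<open>star (star_restrict Y)\<close> is the graph of a function on the internal
  universe \<open>\<Union>Y. elts (star Y)\<close>; \<open>internal_star\<close> is unspecified outside it.
\<close>

definition internal_star :: "('u \<Rightarrow> 'u set) \<Rightarrow> 'u set \<Rightarrow> ('u \<Rightarrow> 'u) \<Rightarrow> 'u \<Rightarrow> 'u" where
  "internal_star elts atoms star \<xi> =
     (THE \<eta>. opair elts atoms \<xi> \<eta> \<in> (\<Union>Y. elts (star (star_restrict elts atoms star Y))))"

end

theory Submission
  imports Defs
begin

text \<open>
  A subset \<open>S\<close> of \<open>I\<close> whose star contains a nonstandard point is infinite, since the star of a
  finite set has only standard members. Let \<open>A = {x \<in> I. (\<^sup>*x, \<beta>) \<in> \<^sup>*X}\<close>. Transfer turns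
  \<open>(\<^sup>\<circledast>\<alpha>, \<^sup>*\<beta>) \<in> \<^sup>*\<^sup>*X\<close> into \<open>\<alpha> \<in> \<^sup>*A\<close>, so \<open>A\<close> is infinite. For each finite \<open>F \<subseteq> A\<close> the
  point \<open>\<beta>\<close> lies in the star of \<open>{y \<in> I. \<forall>x\<in>F. (x, y) \<in> X}\<close>, so this set is infinite as well, and
  the sequences can be chosen recursively. If \<open>\<alpha> = \<beta>\<close>, then \<open>\<alpha>\<close> lies in the stars of both sets, so
  each new term can be taken from \<open>A\<close> again.
\<close>

section \<open>Recursive choice of injective sequences\<close>

text \<open>Only finitely many values are taken before stage \<open>n\<close>, so the infinite set
  \<open>B n\<close> still offers a new one.\<close>

lemma inj_choice_infinite:
  assumes "\<And>n::nat. infinite (B n)"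
  obtains b where "inj b" "\<And>n. b n \<in> B n"
proof -
  have "\<exists>b. \<forall>n. b n \<in> B n \<and> b n \<notin> b ` {..<n}"
  proof (rule dependent_wellorder_choice)
    fix n :: nat and b :: "nat \<Rightarrow> 'a"
    show "\<exists>r. r \<in> B n \<and> r \<notin> b ` {..<n}"
      using assms[of n] by (meson finite_imageI finite_lessThan finite_subset subsetI)
  \<comment> \<open>The remaining goal of the choice rule: the condition at \<open>n\<close> depends
    only on the values of \<open>b\<close> below \<open>n\<close>.\<close>
  qed (metis image_cong lessThan_iff)
  then obtain b where b: "\<And>n. b n \<in> B n" "\<And>n. b n \<notin> b ` {..<n}"
    by blast
  have "inj b"
    by (rule linorder_injI) (metis b(2) image_eqI lessThan_iff)
  with b(1) show thesis
    using that by blast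
qed

lemma inj_sequence_successively_related:
  assumes "\<And>F. finite F \<Longrightarrow> F \<subseteq> A \<Longrightarrow> infinite {y \<in> A. \<forall>x\<in>F. P x y}"
  obtains h :: "nat \<Rightarrow> 'a" where "inj h" "range h \<subseteq> A" "\<And>m n. m < n \<Longrightarrow> P (h m) (h n)"
proof -
  have "\<exists>h. \<forall>n::nat. h n \<in> A \<and> h n \<notin> h ` {..<n} \<and> (\<forall>m<n. P (h m) (h n))"
  proof (rule dependent_wellorder_choice)
    fix n :: nat and h :: "nat \<Rightarrow> 'a"
    assume IH: "\<And>m. m < n \<Longrightarrow> h m \<in> A \<and> h m \<notin> h ` {..<m} \<and> (\<forall>k<m. P (h k) (h m))"
    \<comment> \<open>The hypothesis is applied with \<open>F\<close> the set of earlier terms,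
      which lie in \<open>A\<close> by \<open>IH\<close>.\<close>
    have "infinite {y \<in> A. \<forall>x \<in> h ` {..<n}. P x y}"
      using IH by (intro assms) auto
    then obtain r where "r \<in> {y \<in> A. \<forall>x \<in> h ` {..<n}. P x y}" "r \<notin> h ` {..<n}"
      by (meson finite_imageI finite_lessThan finite_subset subsetI)
    then show "\<exists>r. r \<in> A \<and> r \<notin> h ` {..<n} \<and> (\<forall>m<n. P (h m) r)"
      by auto
  qed (auto simp: image_iff)
  then obtain h where h: "\<And>n::nat. h n \<in> A" "\<And>n. h n \<notin> h ` {..<n}"
      "\<And>m n. m < n \<Longrightarrow> P (h m) (h n)"
    by blast
  have "inj h"
    by (rule linorder_injI) (metis h(2) image_eqI lessThan_iff)
  with h show thesis
    using that by blast
qed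

section \<open>Bounded formulas for pairs\<close>

text \<open>The index \<open>Suc (p + i + j)\<close> exceeds every free index, so the quantifier
  captures none of them.\<close>

definition upair_fm :: "nat \<Rightarrow> nat \<Rightarrow> nat \<Rightarrow> bformula" where
  "upair_fm p i j = Conj (Mem i p) (Conj (Mem j p)
     (let k = Suc (p + i + j) in BAll k p (Disj (Eq k i) (Eq k j))))"

text \<open>Both components of a Kuratowski pair are members of the pair, so bounding the
  quantifiers by \<open>p\<close> loses nothing.\<close>

definition opair_fm :: "nat \<Rightarrow> nat \<Rightarrow> nat \<Rightarrow> bformula" where
  "opair_fm p i j = (let k = Suc (p + i + j); l = Suc k in
     BEx k p (BEx l p (Conj (upair_fm k i i) (Conj (upair_fm l i j) (upair_fm p k l)))))"

definition opair_mem_fm :: "nat \<Rightarrow> nat \<Rightarrow> nat \<Rightarrow> bformula" where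
  "opair_mem_fm i j r = (let k = Suc (i + j + r) in BEx k r (opair_fm k i j))"

lemma sat_upair_fm: "sat elts v (upair_fm p i j) \<longleftrightarrow> elts (v p) = {v i, v j}"
  by (auto simp: upair_fm_def Let_def)

section \<open>Finite sets and ordered pairs in the superstructure\<close>

context superstructure
begin

lemma mono_stage: "mono (stage elts atoms)"
  by (rule mono_iff_le_Suc[THEN iffD2]) auto

lemma elts_subset_stage: "x \<in> stage elts atoms k \<Longrightarrow> elts x \<subseteq> stage elts atoms k"
proof (induction k arbitrary: x)
  case 0
  then show ?case by (simp add: atom_empty)
next
  case (Suc k)
  then show ?case by auto
qed

lemma elts_in_stage: obtains k where "elts x \<subseteq> stage elts atoms k"
  using exhaust elts_subset_stage by (metis UNIV_I UN_E)

lemma finite_subset_stage: "finite S \<Longrightarrow> \<exists>k. S \<subseteq> stage elts atoms k"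
proof (induction rule: finite_induct)
  case (insert x S)
  then obtain k l where "S \<subseteq> stage elts atoms k" "x \<in> stage elts atoms l"
    using exhaust by blast
  then have "insert x S \<subseteq> stage elts atoms (max k l)"
    using monoD[OF mono_stage, of k "max k l"] monoD[OF mono_stage, of l "max k l"] by auto
  then show ?case ..
qed simp

lemma mkset_props:
  assumes "S \<subseteq> stage elts atoms k"
  shows "mkset elts atoms S \<notin> atoms \<and> elts (mkset elts atoms S) = S"
  unfolding mkset_def by (rule theI') (use full[OF assms] ext in blast)

lemma elts_mkset_finite: "finite S \<Longrightarrow> elts (mkset elts atoms S) = S"
  using finite_subset_stage mkset_props by blast

lemma elts_mkset_subset: "S \<subseteq> elts x \<Longrightarrow> elts (mkset elts atoms S) = S"
  by (meson elts_in_stage mkset_props order_trans)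

text \<open>A nonempty member set rules out atoms, so \<open>ext\<close> applies and membership
  alone determines the object.\<close>

lemma eq_mkset_finite_iff:
  assumes "finite S" "S \<noteq> {}"
  shows "x = mkset elts atoms S \<longleftrightarrow> elts x = S"
proof
  assume "elts x = S"
  then have "x \<notin> atoms" using assms(2) atom_empty by blast
  moreover have "mkset elts atoms S \<notin> atoms"
    using finite_subset_stage[OF assms(1)] mkset_props by blast
  ultimately show "x = mkset elts atoms S"
    using \<open>elts x = S\<close> elts_mkset_finite[OF assms(1)] ext by simp
qed (simp add: elts_mkset_finite assms)

lemma eq_opair_iff:
  "p = opair elts atoms a b \<longleftrightarrow>
     (\<exists>u \<in> elts p. \<exists>w \<in> elts p. elts u = {a} \<and> elts w = {a, b} \<and> elts p = {u, w})"
  unfolding opair_def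
  by (subst eq_mkset_finite_iff) (auto simp: elts_mkset_finite simp flip: eq_mkset_finite_iff)

lemma opair_eq_iff [simp]:
  "opair elts atoms a b = opair elts atoms c d \<longleftrightarrow> a = c \<and> b = d"
proof
  assume "opair elts atoms a b = opair elts atoms c d"
  then obtain u w u' w' where "elts u = {a}" "elts w = {a, b}" "elts u' = {c}" "elts w' = {c, d}"
      "{u, w} = {u', w'}"
    using eq_opair_iff[of "opair elts atoms a b"] by metis
  then show "a = c \<and> b = d"
    by (auto simp: doubleton_eq_iff)
qed simp

lemma sat_opair_fm: "sat elts v (opair_fm p i j) \<longleftrightarrow> v p = opair elts atoms (v i) (v j)"
  by (simp add: opair_fm_def Let_def sat_upair_fm eq_opair_iff)

lemma sat_opair_mem_fm:
  "sat elts v (opair_mem_fm i j r) \<longleftrightarrow> opair elts atoms (v i) (v j) \<in> elts (v r)"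
  by (simp add: opair_mem_fm_def Let_def sat_opair_fm)

text \<open>Kuratowski pairs rise two stages, so the graph of a function between sets is again a
  set.\<close>

lemma opair_image_in_stage:
  assumes "S \<subseteq> stage elts atoms k" "f ` S \<subseteq> stage elts atoms k"
  shows "(\<lambda>x. opair elts atoms x (f x)) ` S \<subseteq> stage elts atoms (Suc (Suc k))"
proof clarify
  fix x assume "x \<in> S"
  then have "{x} \<subseteq> stage elts atoms k" "{x, f x} \<subseteq> stage elts atoms k"
    using assms by auto
  from this[THEN mkset_props]
  have "{mkset elts atoms {x}, mkset elts atoms {x, f x}} \<subseteq> stage elts atoms (Suc k)"
    using \<open>x \<in> S\<close> assms by auto
  from mkset_props[OF this] this
  show "opair elts atoms x (f x) \<in> stage elts atoms (Suc (Suc k))"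
    unfolding opair_def by simp
qed

end

section \<open>Elementary consequences of transfer\<close>

context star_map
begin

lemma star_mem_iff: "star x \<in> elts (star y) \<longleftrightarrow> x \<in> elts y"
  using transfer[of "(\<lambda>_. y)(0 := x)" "Mem 0 1"] by simp

text \<open>Induction on the finite set: transfer preserves emptiness and the adjunction of a single
  element.\<close>

lemma elts_star_finite:
  assumes "finite (elts x)"
  shows "elts (star x) = star ` elts x"
proof -
  have "elts (star x) \<subseteq> star ` S" if "finite S" "elts x = S" for S x
    using that
  proof (induction S arbitrary: x rule: finite_induct)
    case empty
    then show ?case
      using transfer[of "\<lambda>_. x" "BAll 1 0 (Neg (Eq 1 1))"] by simp
  next
    case (insert a S)
    let ?y = "mkset elts atoms S"
    have y: "elts ?y = S" by (rule elts_mkset_finite) fact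
    have "\<forall>z \<in> elts (star x). z = star a \<or> z \<in> elts (star ?y)"
      using transfer[of "(\<lambda>_. x)(1 := a, 2 := ?y)" "BAll 3 0 (Disj (Eq 3 1) (Mem 3 2))"]
      by (simp add: insert.prems y)
    with insert.IH[OF y] show ?case by auto
  qed
  with assms show ?thesis by (auto simp: star_mem_iff)
qed

text \<open>\<open>star\<close> maps \<open>elts Y\<close> into \<open>elts (star Y)\<close>, so
  arguments and values share a stage and the graph is a set.\<close>

lemma elts_star_restrict:
  "elts (star_restrict elts atoms star Y) = (\<lambda>y. opair elts atoms y (star y)) ` elts Y"
proof -
  obtain k l where kl: "elts Y \<subseteq> stage elts atoms k" "elts (star Y) \<subseteq> stage elts atoms l"
    by (meson elts_in_stage)
  moreover have "star ` elts Y \<subseteq> elts (star Y)"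
    by (auto simp: star_mem_iff)
  ultimately have "elts Y \<subseteq> stage elts atoms (max k l)" "star ` elts Y \<subseteq> stage elts atoms (max k l)"
    using monoD[OF mono_stage, of k "max k l"] monoD[OF mono_stage, of l "max k l"] by auto
  from mkset_props[OF opair_image_in_stage[OF this]] show ?thesis
    by (simp add: star_restrict_def)
qed

lemma opair_mem_star_restrict_iff:
  "opair elts atoms x y \<in> elts (star_restrict elts atoms star Y) \<longleftrightarrow> x \<in> elts Y \<and> y = star x"
  by (auto simp: elts_star_restrict)

section \<open>The internal star map as a function\<close>

lemma internal_star_exists:
  assumes "\<xi> \<in> elts (star Y)"
  obtains \<eta> where "\<eta> \<in> elts (star (star Y))"
    "opair elts atoms \<xi> \<eta> \<in> elts (star (star_restrict elts atoms star Y))"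
proof -
  have "\<forall>x \<in> elts (star Y). \<exists>y \<in> elts (star (star Y)).
      opair elts atoms x y \<in> elts (star (star_restrict elts atoms star Y))"
    \<comment> \<open>Variable 0 keeps the default value \<open>Y\<close>; the formula says that the
      graph is total on \<open>Y\<close> with values in \<open>star Y\<close>.\<close>
    using transfer[of "(\<lambda>_. Y)(1 := star Y, 2 := star_restrict elts atoms star Y)"
        "BAll 3 0 (BEx 4 1 (opair_mem_fm 3 4 2))"]
    by (simp add: sat_opair_mem_fm opair_mem_star_restrict_iff star_mem_iff)
  with assms that show thesis by blast
qed

text \<open>Supplies the bounds under which the transferred uniqueness statement can be
  instantiated.\<close>

lemma opair_in_star_star_restrictD:
  assumes "opair elts atoms \<xi> \<eta> \<in> elts (star (star_restrict elts atoms star Y))"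
  shows "\<xi> \<in> elts (star Y) \<and> \<eta> \<in> elts (star (star Y))"
proof -
  have "\<forall>q \<in> elts (star (star_restrict elts atoms star Y)).
      \<exists>x \<in> elts (star Y). \<exists>y \<in> elts (star (star Y)). q = opair elts atoms x y"
    using transfer[of "(\<lambda>_. Y)(1 := star Y, 2 := star_restrict elts atoms star Y)"
        "BAll 3 2 (BEx 4 0 (BEx 5 1 (opair_fm 3 4 5)))"]
    by (auto simp: sat_opair_fm elts_star_restrict star_mem_iff)
  with assms show ?thesis by fastforce
qed

text \<open>Two restrictions of \<open>star\<close> agree wherever both are defined, and this
  transfers. Hence the description in \<open>internal_star\<close> is well defined.\<close>

lemma internal_star_unique:
  assumes "opair elts atoms \<xi> \<eta> \<in> elts (star (star_restrict elts atoms star Y))"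
    and "opair elts atoms \<xi> \<zeta> \<in> elts (star (star_restrict elts atoms star Z))"
  shows "\<eta> = \<zeta>"
proof -
  have "\<forall>x \<in> elts (star Y). \<forall>y \<in> elts (star (star Y)). \<forall>z \<in> elts (star (star Z)).
      opair elts atoms x y \<in> elts (star (star_restrict elts atoms star Y)) \<and>
      opair elts atoms x z \<in> elts (star (star_restrict elts atoms star Z)) \<longrightarrow> y = z"
    using transfer[of "(\<lambda>_. Y)(1 := star Y, 2 := star Z, 3 := star_restrict elts atoms star Y,
          4 := star_restrict elts atoms star Z)"
        "BAll 5 0 (BAll 6 1 (BAll 7 2
          (Imp (Conj (opair_mem_fm 5 6 3) (opair_mem_fm 5 7 4)) (Eq 6 7))))"]
    by (simp add: sat_opair_mem_fm opair_mem_star_restrict_iff)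
  with assms opair_in_star_star_restrictD show ?thesis by blast
qed

lemma internal_star_mem:
  assumes "\<xi> \<in> elts (star Y)"
  shows "internal_star elts atoms star \<xi> \<in> elts (star (star Y))"
    and "opair elts atoms \<xi> (internal_star elts atoms star \<xi>)
      \<in> elts (star (star_restrict elts atoms star Y))"
proof -
  obtain \<eta> where \<eta>: "\<eta> \<in> elts (star (star Y))"
      "opair elts atoms \<xi> \<eta> \<in> elts (star (star_restrict elts atoms star Y))"
    using internal_star_exists[OF assms] .
  then have "internal_star elts atoms star \<xi> = \<eta>"
    unfolding internal_star_def using internal_star_unique by blast
  with \<eta> show "internal_star elts atoms star \<xi> \<in> elts (star (star Y))"
    and "opair elts atoms \<xi> (internal_star elts atoms star \<xi>)
      \<in> elts (star (star_restrict elts atoms star Y))"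
    by simp_all
qed

section \<open>Sections of the relation\<close>

text \<open>Although \<open>A\<close> is defined through \<open>star\<close> and \<beta>, it is an
  element of the superstructure. With the graph of \<open>star\<close> on \<open>I\<close> as a
  parameter, its definition transfers: \<open>star x\<close> becomes the internal star of
  \<open>x\<close>, and \<beta> becomes \<open>star \<beta>\<close>.\<close>

lemma mem_star_section:
  assumes "\<alpha> \<in> elts (star I)"
    and "opair elts atoms (internal_star elts atoms star \<alpha>) (star \<beta>) \<in> elts (star Z)"
    and "elts A = {x \<in> elts I. opair elts atoms (star x) \<beta> \<in> elts Z}"
  shows "\<alpha> \<in> elts (star A)"
proof -
  have "\<forall>x \<in> elts (star I). \<forall>y \<in> elts (star (star I)).
      opair elts atoms x y \<in> elts (star (star_restrict elts atoms star I)) \<and>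
      opair elts atoms y (star \<beta>) \<in> elts (star Z) \<longrightarrow> x \<in> elts (star A)"
    using transfer[of "(\<lambda>_. I)(1 := star I, 2 := star_restrict elts atoms star I, 3 := \<beta>,
          4 := Z, 5 := A)"
        "BAll 6 0 (BAll 7 1
          (Imp (Conj (opair_mem_fm 6 7 2) (opair_mem_fm 7 3 4)) (Mem 6 5)))"]
    by (simp add: sat_opair_mem_fm opair_mem_star_restrict_iff assms(3))
  with assms internal_star_mem show ?thesis by blast
qed

text \<open>As \<open>star\<close> adds no points to the finite set \<open>F\<close>, transfer puts
  \<gamma> into the star of the common section. Were that section finite, \<gamma> would be
  standard.\<close>

lemma infinite_common_section:
  assumes "\<gamma> \<in> elts (star D) - star ` elts D" "finite F"
    and "\<And>x. x \<in> F \<Longrightarrow> opair elts atoms (star x) \<gamma> \<in> elts (star X)"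
  shows "infinite {y \<in> elts D. \<forall>x\<in>F. opair elts atoms x y \<in> elts X}" (is "infinite ?B")
proof
  assume fin: "finite ?B"
  let ?b = "mkset elts atoms ?B" and ?f = "mkset elts atoms F"
  have b: "elts ?b = ?B" and f: "elts ?f = F"
    using fin assms(2) by (simp_all add: elts_mkset_finite)
  have "\<forall>y \<in> elts (star D). (\<forall>x \<in> elts (star ?f). opair elts atoms x y \<in> elts (star X))
      \<longrightarrow> y \<in> elts (star ?b)"
    using transfer[of "(\<lambda>_. D)(1 := ?f, 2 := X, 3 := ?b)"
        "BAll 4 0 (Imp (BAll 5 1 (opair_mem_fm 5 4 2)) (Mem 4 3))"]
    by (simp add: sat_opair_mem_fm b f)
  moreover have "elts (star ?f) = star ` F"
    using elts_star_finite[of ?f] assms(2) by (simp add: f)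
  ultimately have "\<gamma> \<in> elts (star ?b)"
    using assms by auto
  moreover have "elts (star ?b) = star ` ?B"
    using elts_star_finite[of ?b] fin by (simp add: b)
  ultimately show False
    using assms(1) by auto
qed

lemma infinite_if_nonstandard_mem_star:
  "\<gamma> \<in> elts (star D) - star ` elts D \<Longrightarrow> infinite (elts D)"
  using elts_star_finite by blast

section \<open>Construction of the sequences\<close>

theorem nonstandard_pair_sequences:
  assumes \<alpha>: "\<alpha> \<in> elts (star I) - star ` elts I"
    and \<beta>: "\<beta> \<in> elts (star I) - star ` elts I"
    and X: "opair elts atoms (internal_star elts atoms star \<alpha>) (star \<beta>) \<in> elts (star (star X))"
  obtains a b :: "nat \<Rightarrow> 'u" where "inj a" "inj b" "range a \<subseteq> elts I" "range b \<subseteq> elts I"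
    "\<And>n m. n \<le> m \<Longrightarrow> opair elts atoms (a n) (b m) \<in> elts X"
proof -
  define A where "A = mkset elts atoms {x \<in> elts I. opair elts atoms (star x) \<beta> \<in> elts (star X)}"
  have A: "elts A = {x \<in> elts I. opair elts atoms (star x) \<beta> \<in> elts (star X)}"
    unfolding A_def by (rule elts_mkset_subset[of _ I]) blast
  \<comment> \<open>Here \<open>Z\<close> is \<open>star X\<close>, so the double star in the
    hypothesis is a single star of \<open>Z\<close>.\<close>
  have "\<alpha> \<in> elts (star A)"
    using mem_star_section[OF _ X A] \<alpha> by blast
  then have "infinite (elts A)"
    using \<alpha> A by (intro infinite_if_nonstandard_mem_star[of \<alpha>]) auto
  then obtain a :: "nat \<Rightarrow> 'u" where a: "inj a" "range a \<subseteq> elts A"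
    using infinite_countable_subset by blast
  \<comment> \<open>The closed range \<open>{..m}\<close> makes the relation hold for
    \<open>n = m\<close> too; all of \<open>a\<close> is fixed before \<open>b\<close> is
    chosen.\<close>
  have "infinite {y \<in> elts I. \<forall>x \<in> a ` {..m}. opair elts atoms x y \<in> elts X}" for m
    using a A by (intro infinite_common_section[OF \<beta>]) auto
  then obtain b :: "nat \<Rightarrow> 'u" where "inj b"
      "\<And>m. b m \<in> {y \<in> elts I. \<forall>x \<in> a ` {..m}. opair elts atoms x y \<in> elts X}"
    using inj_choice_infinite[of "\<lambda>m. {y \<in> elts I. \<forall>x \<in> a ` {..m}. opair elts atoms x y \<in> elts X}"]
    by blast
  with a A show thesis
    by (intro that[of a b]) auto
qed

theorem nonstandard_diagonal_sequence:
  assumes \<alpha>: "\<alpha> \<in> elts (star I) - star ` elts I"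
    and X: "opair elts atoms (internal_star elts atoms star \<alpha>) (star \<alpha>) \<in> elts (star (star X))"
  obtains h :: "nat \<Rightarrow> 'u" where "inj h" "range h \<subseteq> elts I"
    "\<And>n m. n < m \<Longrightarrow> opair elts atoms (h n) (h m) \<in> elts X"
proof -
  define A where "A = mkset elts atoms {x \<in> elts I. opair elts atoms (star x) \<alpha> \<in> elts (star X)}"
  have A: "elts A = {x \<in> elts I. opair elts atoms (star x) \<alpha> \<in> elts (star X)}"
    unfolding A_def by (rule elts_mkset_subset[of _ I]) blast
  have "\<alpha> \<in> elts (star A)"
    using mem_star_section[OF _ X A] \<alpha> by blast
  \<comment> \<open>This allows common sections to be taken inside \<open>A\<close>, so each new
    term can serve as a first coordinate later.\<close>
  then have \<alpha>A: "\<alpha> \<in> elts (star A) - star ` elts A"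
    using \<alpha> A by auto
  have "infinite {y \<in> elts A. \<forall>x\<in>F. opair elts atoms x y \<in> elts X}"
    if "finite F" "F \<subseteq> elts A" for F
    using that A by (intro infinite_common_section[OF \<alpha>A]) auto
  then obtain h :: "nat \<Rightarrow> 'u" where "inj h" "range h \<subseteq> elts A"
      "\<And>n m. n < m \<Longrightarrow> opair elts atoms (h n) (h m) \<in> elts X"
    using inj_sequence_successively_related[of "elts A" "\<lambda>x y. opair elts atoms x y \<in> elts X"]
    by blast
  with A show thesis
    by (intro that[of h]) auto
qed

end

theorem theorem5p1:
  fixes elts :: "'u \<Rightarrow> 'u set" and atoms :: "'u set"
    and real_atom :: "real \<Rightarrow> 'u" and star :: "'u \<Rightarrow> 'u"
    and I X \<alpha> \<beta> :: 'u
  assumes "star_map elts atoms real_atom star"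
    and "infinite (elts I)"
    and "\<alpha> \<in> elts (star I) - star ` elts I"
    and "\<beta> \<in> elts (star I) - star ` elts I"
    and "X \<notin> atoms"
    and "elts X \<subseteq> {opair elts atoms i j | i j. i \<in> elts I \<and> j \<in> elts I}"
  shows "(opair elts atoms (internal_star elts atoms star \<alpha>) (star \<beta>) \<in> elts (star (star X)) \<longrightarrow>
           (\<exists>a b :: nat \<Rightarrow> 'u. inj a \<and> inj b \<and> range a \<subseteq> elts I \<and> range b \<subseteq> elts I \<and>
              (\<forall>n m. n \<le> m \<longrightarrow> opair elts atoms (a n) (b m) \<in> elts X))) \<and>
         (opair elts atoms (internal_star elts atoms star \<alpha>) (star \<alpha>) \<in> elts (star (star X)) \<longrightarrow>
           (\<exists>h :: nat \<Rightarrow> 'u. inj h \<and> range h \<subseteq> elts I \<and>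
              (\<forall>n m. n < m \<longrightarrow> opair elts atoms (h n) (h m) \<in> elts X)))"
proof -
  interpret star_map elts atoms real_atom star by fact
  show ?thesis
    using nonstandard_pair_sequences[OF assms(3,4)] nonstandard_diagonal_sequence[OF assms(3)]
    by metis
qed

end
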